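(* (a) Let $P_1,\ldots,P_k$ be non-collinear points in $\mathbb{R}^n$, and suppose that $P$ is the Fermat point of $P_1,\ldots,P_k$ and that $P$ is distinct from each of $P_1,\ldots,P_k$. For each $i$, let $\mathbf{n}_i$ be the unit vector pointing from $P$ to $P_i$, and let $p_i$ be an oriented hyperplane in $\mathbb{R}^n$ with unit normal $\mathbf{n}_i$. Then $\mathcal{P}=\{p_1,\ldots,p_k\}$ is Viviani. (b) Conversely, let $P\in\mathbb{R}^n$ be a fixed point and let $\mathcal{P}=\{p_1,\ldots,p_k\}$ be a family of oriented hyperplanes in $\mathbb{R}^n$ (not necessarily distinct) with unit normals $\mathbf{n}_1,\ldots,\mathbf{n}_k$, such that either $d(P,p_i)\ge 0$ for all $i$, or $d(P,p_i)\le 0$ for all $i$. For each $i$, let $P_i$ be the orthogonal projection of $P$ onto $p_i$, and suppose that $P_1,\ldots,P_k$ are non-collinear. If $\mathcal{P}$ is Viviani, then $P$ is the Fermat point of $P_1,\ldots,P_k$.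
   Context: For an oriented hyperplane $p_i\subset\mathbb{R}^n$ with specified unit normal $\mathbf{n}_i$ and a point $P\in\mathbb{R}^n$, the signed distance $d(P,p_i)$ is the real number whose absolute value is the Euclidean distance from $P$ to $p_i$, with $d(P,p_i)<0$ if $\mathbf{n}_i$ points to the open half-space (of the complement of $p_i$) containing $P$, and $d(P,p_i)>0$ if $\mathbf{n}_i$ points in the opposite direction (and $d(P,p_i)=0$ if $P\in p_i$). For a finite family $\mathcal{P}=\{p_1,\ldots,p_k\}$ of oriented hyperplanes (repetitions allowed), define $v:\mathbb{R}^n\to\mathbb{R}$ by $v(P)=\sum_{i=1}^k d(P,p_i)$. The family $\mathcal{P}$ is called Viviani if $v$ is a constant function on $\mathbb{R}^n$. Points $P_1,\ldots,P_k\in\mathbb{R}^n$ are non-collinear if they do not all lie on a common line. For non-collinear points $P_1,\ldots,P_k$ there is a unique point $P$, lying in their convex hull, at which the sum of Euclidean distances $\sum_{i=1}^k\|P_i-P\|$ is least possible among all points of $\mathbb{R}^n$; this point is called the Fermat point of $P_1,\ldots,P_k$. (The points are an indexed family; repeated points are counted with multiplicity in the sum.) *)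

theory Defs
  imports "HOL-Analysis.Analysis"
begin

text \<open>An oriented hyperplane is given by its point set together with the chosen unit normal
  (each hyperplane has two of them). Finite families are indexed by \<open>{1..k}\<close>, so repetitions
  are allowed and counted with multiplicity.\<close>

definition oriented_hyperplane :: "'a::euclidean_space set \<Rightarrow> 'a \<Rightarrow> bool" where
  "oriented_hyperplane H nv \<longleftrightarrow> norm nv = 1 \<and> (\<exists>c. H = {x. nv \<bullet> x = c})"

text \<open>The open half-space, among the two bounded by \<open>H\<close>, into which \<open>nv\<close> points.\<close>

definition half_space_towards :: "'a::euclidean_space set \<Rightarrow> 'a \<Rightarrow> 'a set" where
  "half_space_towards H nv = {x + t *\<^sub>R nv | x t. x \<in> H \<and> 0 < t}"

text \<open>The sign is negative on the side into which the normal points; on \<open>H\<close> itself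
  \<open>infdist\<close>, and hence the signed distance, is zero.\<close>

definition signed_dist :: "'a::euclidean_space \<Rightarrow> 'a set \<Rightarrow> 'a \<Rightarrow> real" where
  "signed_dist P H nv =
     (if P \<in> half_space_towards H nv then - infdist P H else infdist P H)"

definition viviani :: "nat \<Rightarrow> (nat \<Rightarrow> 'a::euclidean_space set) \<Rightarrow> (nat \<Rightarrow> 'a) \<Rightarrow> bool" where
  "viviani k p nv \<longleftrightarrow> (\<lambda>P. \<Sum>i=1..k. signed_dist P (p i) (nv i)) constant_on UNIV"

definition orthogonal_projection_of :: "'a::euclidean_space \<Rightarrow> 'a set \<Rightarrow> 'a \<Rightarrow> bool" where
  "orthogonal_projection_of P H A \<longleftrightarrow> A \<in> H \<and> (\<forall>x\<in>H. orthogonal (P - A) (x - A))"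

definition non_collinear :: "nat \<Rightarrow> (nat \<Rightarrow> 'a::euclidean_space) \<Rightarrow> bool" where
  "non_collinear k A \<longleftrightarrow> \<not> collinear (A ` {1..k})"

definition dist_sum :: "nat \<Rightarrow> (nat \<Rightarrow> 'a::euclidean_space) \<Rightarrow> 'a \<Rightarrow> real" where
  "dist_sum k A P = (\<Sum>i=1..k. norm (A i - P))"

text \<open>Only meaningful for non-collinear points; existence, uniqueness and membership in the
  convex hull are proved below.\<close>

definition fermat_point :: "nat \<Rightarrow> (nat \<Rightarrow> 'a::euclidean_space) \<Rightarrow> 'a" where
  "fermat_point k A = (THE P. \<forall>Q. dist_sum k A P \<le> dist_sum k A Q)"

lemma dist_sum_minimizer_unique:
  assumes nc: "non_collinear k A"
    and P: "\<forall>X. dist_sum k A P \<le> dist_sum k A X"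
    and Q: "\<forall>X. dist_sum k A Q \<le> dist_sum k A X"
  shows "P = Q"
proof (rule ccontr)
  assume "P \<noteq> Q"
  define M where "M = midpoint P Q"
  have M: "2 *\<^sub>R (A i - M) = (A i - P) + (A i - Q)" for i
    by (simp add: M_def midpoint_def algebra_simps scaleR_2)
  have M2: "2 * norm (A i - M) = norm ((A i - P) + (A i - Q))" for i
    using arg_cong[OF M[of i], of norm] by simp
  have le: "2 * norm (A i - M) \<le> norm (A i - P) + norm (A i - Q)" for i
    unfolding M2 by (rule norm_triangle_ineq)
  have "\<exists>i\<in>{1..k}. 2 * norm (A i - M) \<noteq> norm (A i - P) + norm (A i - Q)"
  proof (rule ccontr)
    assume "\<not> ?thesis"
    then have eq: "norm ((A i - P) + (A i - Q)) = norm (A i - P) + norm (A i - Q)"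
      if "i \<in> {1..k}" for i
      using that M2 by simp
    have "\<exists>c. A i = P + c *\<^sub>R (P - Q)" if i: "i \<in> {1..k}" for i
    proof -
      let ?x = "A i - P" and ?y = "A i - Q"
      have e: "norm ?x *\<^sub>R ?y = norm ?y *\<^sub>R ?x"
        using eq[OF i] norm_triangle_eq by blast
      have "norm ?x *\<^sub>R (?x + (P - Q)) = norm ?y *\<^sub>R ?x"
        using e by simp
      then have d: "(norm ?y - norm ?x) *\<^sub>R ?x = norm ?x *\<^sub>R (P - Q)"
        unfolding scaleR_add_right scaleR_left_diff_distrib by (metis add_diff_cancel_left')
      have ne: "norm ?y \<noteq> norm ?x"
        using d \<open>P \<noteq> Q\<close> by auto
      have "?x = (norm ?x / (norm ?y - norm ?x)) *\<^sub>R (P - Q)"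
        using arg_cong[OF d, of "scaleR (1 / (norm ?y - norm ?x))"] ne by simp
      then show ?thesis
        by (metis add.commute diff_add_cancel)
    qed
    then have "collinear (A ` {1..k})"
      unfolding collinear_alt by blast
    with nc show False
      by (simp add: non_collinear_def)
  qed
  then have "(\<Sum>i=1..k. 2 * norm (A i - M)) < (\<Sum>i=1..k. norm (A i - P) + norm (A i - Q))"
    using le by (intro sum_strict_mono_ex1) (auto simp: less_le)
  then have "2 * dist_sum k A M < dist_sum k A P + dist_sum k A Q"
    by (simp add: dist_sum_def sum.distrib sum_distrib_left)
  then show False
    using P[rule_format, of M] Q[rule_format, of M] by linarith
qed

lemma dist_sum_minimizer_exists:
  assumes nc: "non_collinear k A"
  shows "\<exists>P \<in> convex hull (A ` {1..k}). \<forall>Q. dist_sum k A P \<le> dist_sum k A Q"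
proof -
  let ?C = "convex hull (A ` {1..k})"
  have C: "compact ?C" "closed ?C" "convex ?C"
    by (simp_all add: finite_imp_compact_convex_hull compact_imp_closed)
  have ne: "?C \<noteq> {}"
    using nc unfolding non_collinear_def by (metis collinear_empty convex_hull_eq_empty)
  have "continuous_on ?C (dist_sum k A)"
    unfolding dist_sum_def by (intro continuous_intros)
  then obtain P where P: "P \<in> ?C" "\<forall>Q\<in>?C. dist_sum k A P \<le> dist_sum k A Q"
    using continuous_attains_inf[OF C(1) ne] by blast
  have "dist_sum k A P \<le> dist_sum k A Q" for Q
  proof -
    have "dist_sum k A P \<le> dist_sum k A (closest_point ?C Q)"
      using P closest_point_in_set[OF C(2) ne] by blast
    also have "\<dots> \<le> dist_sum k A Q"
      unfolding dist_sum_def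
    proof (rule sum_mono)
      fix i assume "i \<in> {1..k}"
      then have "A i \<in> ?C"
        by (simp add: hull_inc)
      then show "norm (A i - closest_point ?C Q) \<le> norm (A i - Q)"
        using closest_point_lipschitz[OF C(3,2) ne, of "A i" Q]
        by (simp add: closest_point_self dist_norm)
    qed
    finally show ?thesis .
  qed
  with P(1) show ?thesis
    by blast
qed

lemma fermat_point_well_defined:
  assumes "non_collinear k A"
  shows "\<exists>!P. \<forall>Q. dist_sum k A P \<le> dist_sum k A Q"
    and "\<forall>Q. dist_sum k A (fermat_point k A) \<le> dist_sum k A Q"
    and "fermat_point k A \<in> convex hull (A ` {1..k})"
proof -
  show ex1: "\<exists>!P. \<forall>Q. dist_sum k A P \<le> dist_sum k A Q"
    using dist_sum_minimizer_exists[OF assms] dist_sum_minimizer_unique[OF assms] by blast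
  show min: "\<forall>Q. dist_sum k A (fermat_point k A) \<le> dist_sum k A Q"
    unfolding fermat_point_def by (rule theI'[OF ex1])
  show "fermat_point k A \<in> convex hull (A ` {1..k})"
    using dist_sum_minimizer_exists[OF assms] dist_sum_minimizer_unique[OF assms _ min] by metis
qed

end

theory Submission
  imports Defs
begin

text \<open>
  For a hyperplane \<open>{x. nv \<bullet> x = c}\<close> the signed distance of \<open>P\<close> is the affine function
  \<open>c - nv \<bullet> P\<close>, so the sum of the signed distances is an affine function whose linear part is
  given by \<open>- (\<Sum>i. nv i)\<close>. It is constant exactly if the unit normals add up to zero
  (lemma \<open>viviani_iff_sum_normals_zero\<close>).

  The vector \<open>- (\<Sum>i. nv i)\<close> is also the gradient at \<open>P\<close> of the distance sum
  \<open>Q \<mapsto> (\<Sum>i. norm (A i - Q))\<close> when each \<open>nv i\<close> is the direction from \<open>P\<close> to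
  \<open>A i\<close>. At a Fermat point distinct from all \<open>A i\<close> this gradient exists and vanishes,
  which is part (a).

  For part (b), the common sign of the distances makes either all \<open>nv i\<close> or all \<open>- nv i\<close>
  point from \<open>P\<close> to its projections \<open>A i\<close>, and both families add up to zero; assume the
  former. Then convexity makes the vanishing of the sum sufficient for a minimum: the distance
  sum lies above the affine function \<open>Q \<mapsto> (\<Sum>i. nv i \<bullet> (A i - Q))\<close>, which is constant,
  and the two agree at \<open>P\<close>. In this form the argument allows \<open>A i = P\<close>, where the norm is
  not differentiable but every unit vector is a subgradient.
\<close>

section \<open>Signed distances as affine functions\<close>

lemma infdist_hyperplane:
  fixes nv :: "'a::euclidean_space"
  assumes "norm nv = 1"
  shows "infdist P {x. nv \<bullet> x = c} = \<bar>c - nv \<bullet> P\<bar>"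
proof (rule antisym)
  let ?F = "P + (c - nv \<bullet> P) *\<^sub>R nv"
  have nn: "nv \<bullet> nv = 1"
    using assms by (simp add: dot_square_norm)
  then have F: "?F \<in> {x. nv \<bullet> x = c}"
    by (simp add: inner_add_right)
  have "dist P ?F = \<bar>c - nv \<bullet> P\<bar>"
    using assms by (simp add: dist_norm)
  with infdist_le[OF F, of P] show "infdist P {x. nv \<bullet> x = c} \<le> \<bar>c - nv \<bullet> P\<bar>"
    by simp
  have "\<bar>c - nv \<bullet> P\<bar> \<le> dist P x" if "nv \<bullet> x = c" for x
  proof -
    have "c - nv \<bullet> P = nv \<bullet> (x - P)"
      using that by (simp add: inner_diff_right)
    then show ?thesis
      using Cauchy_Schwarz_ineq2[of nv "x - P"] assms by (simp add: dist_norm norm_minus_commute)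
  qed
  moreover have "{x. nv \<bullet> x = c} \<noteq> {}"
    using F by blast
  ultimately show "\<bar>c - nv \<bullet> P\<bar> \<le> infdist P {x. nv \<bullet> x = c}"
    unfolding infdist_notempty[OF \<open>{x. nv \<bullet> x = c} \<noteq> {}\<close>] by (intro cINF_greatest) auto
qed

lemma half_space_towards_hyperplane:
  fixes nv :: "'a::euclidean_space"
  assumes "norm nv = 1"
  shows "half_space_towards {x. nv \<bullet> x = c} nv = {x. nv \<bullet> x > c}"
proof -
  have nn: "nv \<bullet> nv = 1"
    using assms by (simp add: dot_square_norm)
  have "y \<in> half_space_towards {x. nv \<bullet> x = c} nv" if "nv \<bullet> y > c" for y
  proof -
    have "nv \<bullet> (y - (nv \<bullet> y - c) *\<^sub>R nv) = c"
      by (simp add: inner_diff_right nn)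
    moreover have "y = (y - (nv \<bullet> y - c) *\<^sub>R nv) + (nv \<bullet> y - c) *\<^sub>R nv"
      by simp
    ultimately show ?thesis
      using that unfolding half_space_towards_def by fastforce
  qed
  then show ?thesis
    by (auto simp: half_space_towards_def inner_add_right nn)
qed

lemma signed_dist_hyperplane:
  assumes "oriented_hyperplane H nv" and "x \<in> H"
  shows "signed_dist P H nv = nv \<bullet> (x - P)"
proof -
  obtain c where nv: "norm nv = 1" and H: "H = {x. nv \<bullet> x = c}"
    using assms(1) unfolding oriented_hyperplane_def by blast
  have "signed_dist P H nv = c - nv \<bullet> P"
    unfolding signed_dist_def H infdist_hyperplane[OF nv] half_space_towards_hyperplane[OF nv]
    by simp
  with assms(2) show ?thesis
    by (simp add: H inner_diff_right)
qed

lemma oriented_hyperplane_nonempty: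
  assumes "oriented_hyperplane H nv"
  obtains x where "x \<in> H"
proof -
  obtain c where "norm nv = 1" and H: "H = {x. nv \<bullet> x = c}"
    using assms unfolding oriented_hyperplane_def by blast
  then have "c *\<^sub>R nv \<in> H"
    by (simp add: dot_square_norm)
  with that show thesis .
qed

text \<open>Moving the point by \<open>X\<close> changes the sum of signed distances by
  \<open>- ((\<Sum>i. nv i) \<bullet> X)\<close>; testing constancy with \<open>X = (\<Sum>i. nv i)\<close> isolates the
  sum of the normals.\<close>

lemma viviani_iff_sum_normals_zero:
  assumes "\<forall>i\<in>{1..k}. oriented_hyperplane (p i) (nv i)"
  shows "viviani k p nv \<longleftrightarrow> (\<Sum>i=1..k. nv i) = 0"
proof -
  let ?S = "\<Sum>i=1..k. nv i"
  let ?v = "\<lambda>P. \<Sum>i=1..k. signed_dist P (p i) (nv i)"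
  have v: "?v P = ?v 0 - ?S \<bullet> P" for P
  proof -
    have "signed_dist P (p i) (nv i) = signed_dist 0 (p i) (nv i) - nv i \<bullet> P"
      if "i \<in> {1..k}" for i
    proof -
      have H: "oriented_hyperplane (p i) (nv i)"
        using assms that by blast
      then obtain x where "x \<in> p i"
        by (rule oriented_hyperplane_nonempty)
      then show ?thesis
        using signed_dist_hyperplane[OF H] by (simp add: inner_diff_right)
    qed
    then show ?thesis
      by (simp add: sum_subtractf inner_sum_left)
  qed
  show ?thesis
  proof
    assume "viviani k p nv"
    then have "?v ?S = ?v 0"
      unfolding viviani_def constant_on_def by (metis UNIV_I)
    with v[of ?S] show "?S = 0"
      by simp
  next
    assume "?S = 0"
    with v have "?v P = ?v 0" for P
      by simp
    then show "viviani k p nv"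
      unfolding viviani_def constant_on_def by blast
  qed
qed

section \<open>Minimizers of the distance sum\<close>

text \<open>The necessary condition: away from the \<open>A i\<close> the distance sum is differentiable,
  and its gradient at \<open>P\<close> is minus the sum of the directions towards the \<open>A i\<close>.\<close>

lemma sum_directions_zero_if_minimizer:
  fixes A :: "nat \<Rightarrow> 'a::euclidean_space"
  assumes min: "\<forall>Q. dist_sum k A P \<le> dist_sum k A Q"
    and ne: "\<forall>i\<in>{1..k}. P \<noteq> A i"
  shows "(\<Sum>i=1..k. sgn (A i - P)) = 0"
proof -
  let ?S = "\<Sum>i=1..k. sgn (A i - P)"
  have "((\<lambda>Q. norm (A i - Q)) has_derivative (\<lambda>h. (0 - h) \<bullet> sgn (A i - P))) (at P)"
    if "i \<in> {1..k}" for i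
  proof -
    have "((\<lambda>Q. A i - Q) has_derivative (\<lambda>h. 0 - h)) (at P)"
      by (intro derivative_intros)
    moreover have "(norm has_derivative (\<lambda>h. h \<bullet> sgn (A i - P))) (at (A i - P))"
      using ne that by (intro has_derivative_norm) auto
    ultimately show ?thesis
      by (rule has_derivative_compose)
  qed
  then have "(dist_sum k A has_derivative (\<lambda>h. \<Sum>i=1..k. (0 - h) \<bullet> sgn (A i - P))) (at P)"
    unfolding dist_sum_def by (intro has_derivative_sum) auto
  then have "(\<lambda>h. \<Sum>i=1..k. (0 - h) \<bullet> sgn (A i - P)) = (\<lambda>h. 0)"
    by (rule differential_zero_maxmin[where S = UNIV and x = P, OF UNIV_I open_UNIV]) (use min in auto)
  then have "(\<Sum>i=1..k. (0 - ?S) \<bullet> sgn (A i - P)) = 0"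
    by meson
  then have "?S \<bullet> ?S = 0"
    by (simp add: sum_negf flip: inner_sum_right)
  then show ?thesis
    by simp
qed

text \<open>The sufficient condition: each \<open>Q \<mapsto> u i \<bullet> (A i - Q)\<close> supports
  \<open>Q \<mapsto> norm (A i - Q)\<close> from below and touches it at \<open>P\<close>. The sum of these
  supporting functions does not depend on \<open>Q\<close>.\<close>

lemma minimizer_if_sum_subgradients_zero:
  fixes A :: "nat \<Rightarrow> 'a::euclidean_space"
  assumes u: "\<And>i. i \<in> {1..k} \<Longrightarrow> norm (u i) \<le> 1"
    and touch: "\<And>i. i \<in> {1..k} \<Longrightarrow> norm (A i - P) = u i \<bullet> (A i - P)"
    and zero: "(\<Sum>i=1..k. u i) = 0"
  shows "dist_sum k A P \<le> dist_sum k A Q"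
proof -
  have "dist_sum k A P = (\<Sum>i=1..k. u i \<bullet> (A i - P))"
    unfolding dist_sum_def by (intro sum.cong touch refl)
  also have "\<dots> = (\<Sum>i=1..k. u i \<bullet> (A i - Q)) + (\<Sum>i=1..k. u i) \<bullet> (Q - P)"
    by (simp add: inner_sum_left inner_diff_right sum_subtractf)
  also have "\<dots> = (\<Sum>i=1..k. u i \<bullet> (A i - Q))"
    using zero by simp
  also have "\<dots> \<le> dist_sum k A Q"
    unfolding dist_sum_def
  proof (rule sum_mono)
    fix i assume "i \<in> {1..k}"
    then have "norm (u i) * norm (A i - Q) \<le> norm (A i - Q)"
      using u by (simp add: mult_left_le_one_le)
    with norm_cauchy_schwarz[of "u i" "A i - Q"] show "u i \<bullet> (A i - Q) \<le> norm (A i - Q)"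
      by linarith
  qed
  finally show ?thesis .
qed

lemma fermat_point_eqI:
  assumes "non_collinear k A" and "\<And>Q. dist_sum k A P \<le> dist_sum k A Q"
  shows "P = fermat_point k A"
  using dist_sum_minimizer_unique[OF assms(1)] fermat_point_well_defined(2)[OF assms(1)] assms(2)
  by blast

section \<open>Projections onto hyperplanes and the equivalence\<close>

lemma orthogonal_projection_hyperplane:
  assumes H: "oriented_hyperplane H nv" and A: "orthogonal_projection_of P H A"
  shows "A - P = signed_dist P H nv *\<^sub>R nv"
proof -
  obtain c where nv: "norm nv = 1" and Hc: "H = {x. nv \<bullet> x = c}"
    using H unfolding oriented_hyperplane_def by blast
  have AH: "A \<in> H" and orth: "\<And>x. x \<in> H \<Longrightarrow> (P - A) \<bullet> (x - A) = 0"
    using A unfolding orthogonal_projection_of_def orthogonal_def by auto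
  \<comment> \<open>The component of \<open>A - P\<close> parallel to the hyperplane; it vanishes because it is
    orthogonal to itself.\<close>
  define w where "w = (A - P) - (nv \<bullet> (A - P)) *\<^sub>R nv"
  have nw: "nv \<bullet> w = 0"
    using nv by (simp add: w_def inner_diff_right dot_square_norm)
  then have "A + w \<in> H"
    using AH by (simp add: Hc inner_add_right)
  then have "(A - P) \<bullet> w = 0"
    using orth[of "A + w"] by (simp add: inner_diff_left)
  moreover have "w \<bullet> w = (A - P) \<bullet> w - (nv \<bullet> (A - P)) * (nv \<bullet> w)"
    by (subst (1) w_def) (simp add: inner_diff_left)
  ultimately have "w \<bullet> w = 0"
    using nw by simp
  then have "w = 0"
    by simp
  then show ?thesis
    using signed_dist_hyperplane[OF H AH] by (simp add: w_def)
qed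

theorem theorem2:
  fixes k :: nat
  shows
    "(\<forall>(A :: nat \<Rightarrow> real ^ 'n) P nv p.
        non_collinear k A \<longrightarrow>
        P = fermat_point k A \<longrightarrow>
        (\<forall>i\<in>{1..k}. P \<noteq> A i) \<longrightarrow>
        (\<forall>i\<in>{1..k}. nv i = (1 / norm (A i - P)) *\<^sub>R (A i - P)) \<longrightarrow>
        (\<forall>i\<in>{1..k}. oriented_hyperplane (p i) (nv i)) \<longrightarrow>
        viviani k p nv)
     \<and>
     (\<forall>(P :: real ^ 'n) p nv A.
        (\<forall>i\<in>{1..k}. oriented_hyperplane (p i) (nv i)) \<longrightarrow>
        (\<forall>i\<in>{1..k}. signed_dist P (p i) (nv i) \<ge> 0) \<or>
          (\<forall>i\<in>{1..k}. signed_dist P (p i) (nv i) \<le> 0) \<longrightarrow>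
        (\<forall>i\<in>{1..k}. orthogonal_projection_of P (p i) (A i)) \<longrightarrow>
        non_collinear k A \<longrightarrow>
        viviani k p nv \<longrightarrow>
        P = fermat_point k A)"
proof (intro conjI allI impI)
  fix A :: "nat \<Rightarrow> real ^ 'n" and P nv p
  assume nc: "non_collinear k A" and P: "P = fermat_point k A"
    and ne: "\<forall>i\<in>{1..k}. P \<noteq> A i"
    and nv: "\<forall>i\<in>{1..k}. nv i = (1 / norm (A i - P)) *\<^sub>R (A i - P)"
    and H: "\<forall>i\<in>{1..k}. oriented_hyperplane (p i) (nv i)"
  have "(\<Sum>i=1..k. sgn (A i - P)) = 0"
    using fermat_point_well_defined(2)[OF nc] ne unfolding P
    by (rule sum_directions_zero_if_minimizer)
  moreover have "(\<Sum>i=1..k. nv i) = (\<Sum>i=1..k. sgn (A i - P))"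
    using nv by (intro sum.cong) (auto simp: sgn_div_norm divide_inverse_commute)
  ultimately show "viviani k p nv"
    using viviani_iff_sum_normals_zero[OF H] by simp
next
  fix P :: "real ^ 'n" and p nv A
  assume H: "\<forall>i\<in>{1..k}. oriented_hyperplane (p i) (nv i)"
    and sign: "(\<forall>i\<in>{1..k}. signed_dist P (p i) (nv i) \<ge> 0) \<or>
      (\<forall>i\<in>{1..k}. signed_dist P (p i) (nv i) \<le> 0)"
    and A: "\<forall>i\<in>{1..k}. orthogonal_projection_of P (p i) (A i)"
    and nc: "non_collinear k A" and viv: "viviani k p nv"
  let ?d = "\<lambda>i. signed_dist P (p i) (nv i)"
  \<comment> \<open>Reversing all normals exchanges the two sign conditions, so one common sign \<open>s\<close>
    makes \<open>s *\<^sub>R nv i\<close> point from \<open>P\<close> towards \<open>A i\<close> whenever they differ.\<close>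
  obtain s :: real where s: "\<bar>s\<bar> = 1" and sd: "\<And>i. i \<in> {1..k} \<Longrightarrow> s * ?d i = \<bar>?d i\<bar>"
  proof (cases "\<forall>i\<in>{1..k}. ?d i \<ge> 0")
    case True
    then show thesis
      by (intro that[of 1]) auto
  next
    case False
    with sign have "\<forall>i\<in>{1..k}. ?d i \<le> 0"
      by blast
    then show thesis
      by (intro that[of "-1"]) auto
  qed
  have "dist_sum k A P \<le> dist_sum k A Q" for Q
  proof (rule minimizer_if_sum_subgradients_zero)
    show "(\<Sum>i=1..k. s *\<^sub>R nv i) = 0"
      using viv viviani_iff_sum_normals_zero[OF H] by (simp flip: scaleR_sum_right)
  next
    fix i assume i: "i \<in> {1..k}"
    have n: "norm (nv i) = 1"
      using H i unfolding oriented_hyperplane_def by blast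
    then show "norm (s *\<^sub>R nv i) \<le> 1"
      by (simp add: s)
    have "A i - P = ?d i *\<^sub>R nv i"
      using orthogonal_projection_hyperplane H A i by blast
    then show "norm (A i - P) = (s *\<^sub>R nv i) \<bullet> (A i - P)"
      using sd[OF i] n by (simp add: dot_square_norm mult.commute)
  qed
  with nc show "P = fermat_point k A"
    by (rule fermat_point_eqI)
qed

end
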